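(* Let $T$ be an infinite rooted tree, let $0<p<q<\infty$, let $\psi:T\to\mathbb{C}$, and let $M_\psi:\mathbb{T}_p\to\mathbb{T}_q$ be a bounded multiplication operator. Then $M_\psi$ is a compact operator if and only if $$c_n^{\frac1p-\frac1q}M_\infty(n,\psi)\to0\quad\text{as } n\to\infty,\quad\text{i.e., } M_\infty(n,\psi)=o\big(c_n^{\frac1q-\frac1p}\big).$$
   Context: Let $T$ be an infinite rooted tree with root $o$; $T$ also denotes its vertex set. For a vertex $v$, $|v|$ is the number of edges in the unique path from $o$ to $v$. For $n\in\mathbb{N}_0=\{0,1,2,\dots\}$, $D_n=\{v\in T:|v|=n\}$, and $c_n$ is the number of elements of $D_n$, assumed finite for each $n$ (so $1\le c_n<\infty$). For $f:T\to\mathbb{C}$ and $0<p<\infty$ put $M_p(n,f)=\left(\frac1{c_n}\sum_{|v|=n}|f(v)|^p\right)^{1/p}$, $\|f\|_p=\sup_{n\in\mathbb{N}_0}M_p(n,f)$ and $\mathbb{T}_p=\{f:T\to\mathbb{C}:\|f\|_p<\infty\}$; also $M_\infty(n,f)=\max_{|v|=n}|f(v)|$. For $\psi:T\to\mathbb{C}$, $M_\psi f=\psi f$ (pointwise product). $M_\psi:X\to Y$ is bounded if it maps $X$ into $Y$ and $\sup\{\|\psi f\|_Y/\|f\|_X: f\in X, f\neq0\}<\infty$. It is compact if for every $\|\cdot\|_X$-bounded sequence $\{f_n\}$ in $X$ the sequence $\{\psi f_n\}$ has a subsequence converging in $Y$ with respect to $\|\cdot\|_Y$. *)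

theory Defs
  imports
    "HOL-Analysis.Analysis"
    "HOL-Library.Landau_Symbols"
    "Graph_Theory.Graph_Theory"
begin

text \<open>
  A simple, possibly infinite graph is a symmetric loop-free digraph whose arcs are pairs of
  vertices, that is, \<^locale>\<open>pair_bidirected_digraph\<close>. It is a tree if any two vertices are
  joined by exactly one path. The library constant \<^const>\<open>tree\<close> is not used: it forbids directed
  cycles, and every edge of a symmetric digraph gives a directed cycle of length two.
\<close>

definition infinite_rooted_tree :: "'v pair_pre_digraph \<Rightarrow> 'v \<Rightarrow> bool" where
  "infinite_rooted_tree T r \<longleftrightarrow>
     pair_bidirected_digraph T \<and>
     (\<forall>u\<in>pverts T. \<forall>v\<in>pverts T. \<exists>!w. pre_digraph.apath (with_proj T) u w v) \<and>
     infinite (pverts T) \<and> r \<in> pverts T"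

definition depth :: "'v pair_pre_digraph \<Rightarrow> 'v \<Rightarrow> 'v \<Rightarrow> nat" where
  "depth T r v = length (THE w. pre_digraph.apath (with_proj T) r w v)"

definition level :: "'v pair_pre_digraph \<Rightarrow> 'v \<Rightarrow> nat \<Rightarrow> 'v set" where
  "level T r n = {v \<in> pverts T. depth T r v = n}"

definition mean :: "'v pair_pre_digraph \<Rightarrow> 'v \<Rightarrow> real \<Rightarrow> nat \<Rightarrow> ('v \<Rightarrow> complex) \<Rightarrow> real" where
  "mean T r p n f =
     (1 / real (card (level T r n)) * (\<Sum>v\<in>level T r n. norm (f v) powr p)) powr (1 / p)"

definition mean_infty :: "'v pair_pre_digraph \<Rightarrow> 'v \<Rightarrow> nat \<Rightarrow> ('v \<Rightarrow> complex) \<Rightarrow> real" where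
  "mean_infty T r n f = Max ((\<lambda>v. norm (f v)) ` level T r n)"

text \<open>The supremum is taken in the extended nonnegative reals, so it is \<open>\<infinity>\<close> if the means
  are unbounded.\<close>

definition tnorm :: "'v pair_pre_digraph \<Rightarrow> 'v \<Rightarrow> real \<Rightarrow> ('v \<Rightarrow> complex) \<Rightarrow> ennreal" where
  "tnorm T r p f = (SUP n. ennreal (mean T r p n f))"

text \<open>A function on the vertex set is represented by its extension by zero to the whole
  type. Hence equality of functions, and being the zero function, have their usual meaning.\<close>

definition tspace :: "'v pair_pre_digraph \<Rightarrow> 'v \<Rightarrow> real \<Rightarrow> ('v \<Rightarrow> complex) set" where
  "tspace T r p = {f. (\<forall>v. v \<notin> pverts T \<longrightarrow> f v = 0) \<and> tnorm T r p f < \<infinity>}"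

definition mult_op :: "('v \<Rightarrow> complex) \<Rightarrow> ('v \<Rightarrow> complex) \<Rightarrow> ('v \<Rightarrow> complex)" where
  "mult_op \<psi> f = (\<lambda>v. \<psi> v * f v)"

text \<open>In the next two definitions, \<open>(X, NX)\<close> and \<open>(Y, NY)\<close> are spaces of functions together with
  their (quasi-)norms.\<close>

definition bounded_op ::
  "('v \<Rightarrow> complex) set \<Rightarrow> (('v \<Rightarrow> complex) \<Rightarrow> ennreal) \<Rightarrow>
   ('v \<Rightarrow> complex) set \<Rightarrow> (('v \<Rightarrow> complex) \<Rightarrow> ennreal) \<Rightarrow>
   (('v \<Rightarrow> complex) \<Rightarrow> ('v \<Rightarrow> complex)) \<Rightarrow> bool" where
  "bounded_op X NX Y NY A \<longleftrightarrow>
     (\<forall>f\<in>X. A f \<in> Y) \<and> (SUP f\<in>X - {\<lambda>_. 0}. NY (A f) / NX f) < \<infinity>"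

definition compact_op ::
  "('v \<Rightarrow> complex) set \<Rightarrow> (('v \<Rightarrow> complex) \<Rightarrow> ennreal) \<Rightarrow>
   ('v \<Rightarrow> complex) set \<Rightarrow> (('v \<Rightarrow> complex) \<Rightarrow> ennreal) \<Rightarrow>
   (('v \<Rightarrow> complex) \<Rightarrow> ('v \<Rightarrow> complex)) \<Rightarrow> bool" where
  "compact_op X NX Y NY A \<longleftrightarrow>
     (\<forall>F :: nat \<Rightarrow> 'v \<Rightarrow> complex. (\<forall>k. F k \<in> X) \<and> (SUP k. NX (F k)) < \<infinity> \<longrightarrow>
        (\<exists>(s :: nat \<Rightarrow> nat) g. strict_mono s \<and> g \<in> Y \<and>
           (\<lambda>k. NY (\<lambda>v. A (F (s k)) v - g v)) \<longlonglongrightarrow> 0))"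

end

theory Submission
  imports Defs "HOL-Complex_Analysis.Great_Picard"
begin

text \<open>
  Write \<open>A n = c\<^sub>n powr (1/p - 1/q) * M\<^sub>\<infinity>(n, \<psi>)\<close>. If \<open>v\<close> is a vertex of level \<open>n\<close> where \<open>|\<psi>|\<close> attains
  its maximum, then \<open>c\<^sub>n powr (1/p)\<close> times the indicator of \<open>v\<close> is a unit vector whose image has norm
  \<open>A n\<close>. Such images tend to zero pointwise, so a convergent subsequence has limit zero, and
  compactness forces \<open>A n \<longlonglongrightarrow> 0\<close>. Conversely, a bounded sequence is bounded at each vertex, so a
  diagonal subsequence converges pointwise. The antitonicity of the \<open>l\<^sup>p\<close> norms in \<open>p\<close> gives
  \<open>M\<^sub>q(n, \<psi> h) \<le> A n * M\<^sub>p(n, h)\<close>, so all high levels of the error are small uniformly along the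
  sequence, and the finitely many low levels are controlled by pointwise convergence.
\<close>

lemma level_disjoint: "v \<in> level T r m \<Longrightarrow> v \<in> level T r n \<Longrightarrow> m = n"
  by (simp add: level_def)

lemma mem_level_depth: "v \<in> pverts T \<Longrightarrow> v \<in> level T r (depth T r v)"
  by (simp add: level_def)

lemma level_predecessor:
  assumes T: "infinite_rooted_tree T r" and v: "v \<in> level T r (Suc n)"
  shows "level T r n \<noteq> {}"
proof -
  interpret pair_bidirected_digraph T
    using T by (simp add: infinite_rooted_tree_def)
  have r: "r \<in> pverts T" and vT: "v \<in> pverts T"
    using T v by (auto simp: infinite_rooted_tree_def level_def)
  have unique: "\<exists>!w. apath r w u" if "u \<in> pverts T" for u
    using T r that by (simp add: infinite_rooted_tree_def)
  define w where "w = (THE w. apath r w v)"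
  have w: "apath r w v"
    unfolding w_def by (rule theI') (rule unique[OF vT])
  have "length w = Suc n"
    using v by (simp add: level_def depth_def w_def)
  then obtain w' e where w': "w = w' @ [e]" "length w' = n"
    by (cases w rule: rev_exhaust) auto
  define u where "u = awlast r w'"
  have u: "apath r w' u"
    using w unfolding w' u_def apath_append_iff by simp
  then have uT: "u \<in> pverts T"
    by (auto simp: apath_def)
  have "(THE w. apath r w u) = w'"
    using unique[OF uT] u by (auto intro: the1_equality)
  then have "u \<in> level T r n"
    using uT w' by (simp add: level_def depth_def)
  then show ?thesis by blast
qed

lemma level_nonempty:
  assumes T: "infinite_rooted_tree T r" and fin: "\<And>n. finite (level T r n)"
  shows "level T r n \<noteq> {}"
proof
  assume n: "level T r n = {}"
  have "level T r m = {}" if "n \<le> m" for m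
    using that by (induction m rule: dec_induct) (use n level_predecessor[OF T] in blast)+
  then have "depth T r v < n" if "v \<in> pverts T" for v
    using mem_level_depth[OF that, of r] by (metis empty_iff not_le)
  then have "pverts T \<subseteq> (\<Union>m<n. level T r m)"
    using mem_level_depth by fastforce
  moreover have "finite (\<Union>m<n. level T r m)"
    using fin by blast
  ultimately have "finite (pverts T)"
    by (rule finite_subset)
  then show False
    using T by (simp add: infinite_rooted_tree_def)
qed

lemma countable_pverts:
  assumes "\<And>n. finite (level T r n)"
  shows "countable (pverts T)"
proof (rule countable_subset)
  show "pverts T \<subseteq> (\<Union>n. level T r n)"
    using mem_level_depth by fastforce
  show "countable (\<Union>n. level T r n)"
    using assms by (simp add: countable_finite)
qed

lemma sum_powr_root_antimono:
  fixes x :: "'a \<Rightarrow> real"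
  assumes A: "finite A" and x: "\<And>a. a \<in> A \<Longrightarrow> 0 \<le> x a" and p: "0 < p" "p \<le> q"
  shows "(\<Sum>a\<in>A. x a powr q) powr (1 / q) \<le> (\<Sum>a\<in>A. x a powr p) powr (1 / p)"
proof -
  define S where "S = (\<Sum>a\<in>A. x a powr p)"
  have S: "0 \<le> S"
    unfolding S_def by (simp add: sum_nonneg)
  have le: "x a powr q \<le> x a powr p * S powr ((q - p) / p)" if a: "a \<in> A" for a
  proof -
    have "x a powr p \<le> S"
      unfolding S_def by (rule member_le_sum) (use A a in auto)
    then have "(x a powr p) powr (1 / p) \<le> S powr (1 / p)"
      using p by (intro powr_mono2) auto
    then have "x a \<le> S powr (1 / p)"
      using p x[OF a] by (simp add: powr_powr)
    then have "x a powr (q - p) \<le> (S powr (1 / p)) powr (q - p)"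
      using p x[OF a] by (intro powr_mono2) auto
    then have "x a powr p * x a powr (q - p) \<le> x a powr p * S powr ((q - p) / p)"
      by (intro mult_left_mono) (auto simp: powr_powr)
    then show ?thesis
      by (simp flip: powr_add)
  qed
  have "(\<Sum>a\<in>A. x a powr q) \<le> S * S powr ((q - p) / p)"
    using sum_mono[of A, OF le] by (simp add: S_def sum_distrib_right)
  also have "\<dots> = S powr (q / p)"
  proof (cases "S = 0")
    case False
    then have "S * S powr ((q - p) / p) = S powr (1 + (q - p) / p)"
      using S by (simp add: powr_add)
    also have "1 + (q - p) / p = q / p"
      using p by (simp add: field_simps)
    finally show ?thesis .
  qed simp
  finally have "(\<Sum>a\<in>A. x a powr q) powr (1 / q) \<le> (S powr (q / p)) powr (1 / q)"
    using p by (intro powr_mono2) (auto intro: sum_nonneg)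
  also have "\<dots> = S powr (1 / p)"
    using p by (simp add: powr_powr)
  finally show ?thesis
    by (simp add: S_def)
qed

lemma norm_add_powr_le:
  fixes a b :: "'a::real_normed_vector"
  assumes "0 < p"
  shows "norm (a + b) powr p \<le> 2 powr p * (norm a powr p + norm b powr p)"
proof -
  define m where "m = max (norm a) (norm b)"
  have "norm (a + b) \<le> 2 * m"
    using norm_triangle_ineq[of a b] by (simp add: m_def)
  then have "norm (a + b) powr p \<le> (2 * m) powr p"
    using assms by (intro powr_mono2) auto
  also have "\<dots> = 2 powr p * m powr p"
    by (simp add: powr_mult m_def)
  also have "m powr p \<le> norm a powr p + norm b powr p"
    by (simp add: m_def max_def)
  finally show ?thesis by simp
qed

lemma mean_nonneg: "0 \<le> mean T r p n f"
  by (simp add: mean_def)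

lemma mean_cong:
  "(\<And>v. v \<in> level T r n \<Longrightarrow> norm (f v) = norm (g v)) \<Longrightarrow> mean T r p n f = mean T r p n g"
  by (simp add: mean_def)

lemma mean_eq_0_level:
  assumes "finite (level T r n)" and "0 < p" and "mean T r p n f = 0" and v: "v \<in> level T r n"
  shows "f v = 0"
proof -
  have "card (level T r n) \<noteq> 0"
    using assms by auto
  then have "(\<Sum>v\<in>level T r n. norm (f v) powr p) = 0"
    using assms by (simp add: mean_def)
  then show ?thesis
    using assms by (simp add: sum_nonneg_eq_0_iff)
qed

lemma mean_powr:
  assumes "0 < p"
  shows "mean T r p n f powr p = 1 / real (card (level T r n)) * (\<Sum>v\<in>level T r n. norm (f v) powr p)"
  using assms by (simp add: mean_def powr_powr sum_nonneg)

lemma mean_eq_mult: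
  "mean T r p n f =
     real (card (level T r n)) powr (- (1 / p)) * (\<Sum>v\<in>level T r n. norm (f v) powr p) powr (1 / p)"
  unfolding mean_def
  by (subst powr_mult) (auto simp: sum_nonneg powr_minus_divide powr_divide)

lemma norm_le_mean:
  assumes "finite (level T r n)" and v: "v \<in> level T r n" and p: "0 < p"
  shows "norm (f v) \<le> real (card (level T r n)) powr (1 / p) * mean T r p n f"
proof -
  have "card (level T r n) > 0"
    using assms by (auto simp: card_gt_0_iff)
  then have *: "real (card (level T r n)) powr (1 / p) * mean T r p n f =
      (\<Sum>v\<in>level T r n. norm (f v) powr p) powr (1 / p)"
    by (simp add: mean_eq_mult powr_minus)
  have "norm (f v) powr p \<le> (\<Sum>v\<in>level T r n. norm (f v) powr p)"
    by (rule member_le_sum) (use assms in auto)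
  then have "(norm (f v) powr p) powr (1 / p) \<le> (\<Sum>v\<in>level T r n. norm (f v) powr p) powr (1 / p)"
    using p by (intro powr_mono2) auto
  then show ?thesis
    unfolding * using p by (simp add: powr_powr)
qed

lemma norm_le_mean_infty:
  "finite (level T r n) \<Longrightarrow> v \<in> level T r n \<Longrightarrow> norm (f v) \<le> mean_infty T r n f"
  by (simp add: mean_infty_def)

lemma mean_infty_attained:
  assumes "finite (level T r n)" and "level T r n \<noteq> {}"
  obtains v where "v \<in> level T r n" and "mean_infty T r n f = norm (f v)"
proof -
  have "mean_infty T r n f \<in> (\<lambda>v. norm (f v)) ` level T r n"
    unfolding mean_infty_def using assms by (intro Max_in) auto
  then show thesis
    using that by blast
qed

lemma mean_infty_nonneg:
  "finite (level T r n) \<Longrightarrow> level T r n \<noteq> {} \<Longrightarrow> 0 \<le> mean_infty T r n f"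
  by (metis mean_infty_attained norm_ge_zero)

lemma mean_mult_op_le:
  assumes fin: "finite (level T r n)" and ne: "level T r n \<noteq> {}" and p: "0 < p" "p < q"
  shows "mean T r q n (mult_op \<psi> f) \<le>
    real (card (level T r n)) powr (1 / p - 1 / q) * mean_infty T r n \<psi> * mean T r p n f"
proof -
  define c M where "c = real (card (level T r n))" and "M = mean_infty T r n \<psi>"
  define Sp Sq where "Sp = (\<Sum>v\<in>level T r n. norm (f v) powr p)"
    and "Sq = (\<Sum>v\<in>level T r n. norm (f v) powr q)"
  have c: "0 < c"
    using fin ne by (auto simp: c_def card_gt_0_iff)
  have M: "0 \<le> M"
    using mean_infty_nonneg[OF fin ne] by (simp add: M_def)
  have "(\<Sum>v\<in>level T r n. norm (mult_op \<psi> f v) powr q) \<le> (\<Sum>v\<in>level T r n. M powr q * norm (f v) powr q)"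
    using p norm_le_mean_infty[OF fin, of _ \<psi>]
    by (intro sum_mono) (auto simp: mult_op_def norm_mult powr_mult M_def intro!: mult_right_mono powr_mono2)
  also have "\<dots> = M powr q * Sq"
    by (simp add: Sq_def sum_distrib_left)
  finally have "mean T r q n (mult_op \<psi> f) \<le> c powr (- (1 / q)) * (M powr q * Sq) powr (1 / q)"
    using p unfolding mean_eq_mult c_def by (intro mult_left_mono powr_mono2) (auto simp: sum_nonneg)
  also have "(M powr q * Sq) powr (1 / q) = M * Sq powr (1 / q)"
    using p M by (simp add: powr_mult powr_powr Sq_def sum_nonneg)
  also have "Sq powr (1 / q) \<le> Sp powr (1 / p)"
    unfolding Sq_def Sp_def using p fin by (intro sum_powr_root_antimono) auto
  also have "c powr (- (1 / q)) * (M * Sp powr (1 / p)) =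
      c powr (1 / p - 1 / q) * M * (c powr (- (1 / p)) * Sp powr (1 / p))"
    using c by (simp add: powr_diff powr_minus field_simps)
  also have "c powr (- (1 / p)) * Sp powr (1 / p) = mean T r p n f"
    by (simp add: mean_eq_mult c_def Sp_def)
  finally show ?thesis
    using M by (simp add: mult_left_mono c_def M_def)
qed

lemma mean_diff_le:
  assumes p: "0 < p" and f: "mean T r p n f \<le> B" and g: "mean T r p n g \<le> B"
  shows "mean T r p n (\<lambda>v. f v - g v) \<le> 2 * 2 powr (1 / p) * B"
proof -
  define c where "c = real (card (level T r n))"
  have B: "0 \<le> B"
    by (rule order_trans[OF mean_nonneg f])
  have "(\<Sum>v\<in>level T r n. norm (f v - g v) powr p) \<le>
      (\<Sum>v\<in>level T r n. 2 powr p * (norm (f v) powr p + norm (g v) powr p))"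
    using norm_add_powr_le[OF p, of "f v" "- g v" for v] by (intro sum_mono) simp
  then have "1 / c * (\<Sum>v\<in>level T r n. norm (f v - g v) powr p) \<le>
      1 / c * (\<Sum>v\<in>level T r n. 2 powr p * (norm (f v) powr p + norm (g v) powr p))"
    by (intro mult_left_mono) (auto simp: c_def)
  also have "\<dots> = 2 powr p * (mean T r p n f powr p + mean T r p n g powr p)"
    by (simp add: mean_powr[OF p] c_def sum.distrib sum_distrib_left[symmetric] add_divide_distrib[symmetric])
  also have "\<dots> \<le> 2 powr p * (B powr p + B powr p)"
    using p f g by (intro mult_left_mono add_mono powr_mono2) (auto simp: mean_nonneg)
  also have "\<dots> = 2 powr p * 2 * B powr p"
    by simp
  finally have "mean T r p n (\<lambda>v. f v - g v) \<le> (2 powr p * 2 * B powr p) powr (1 / p)"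
    using p unfolding mean_def c_def by (intro powr_mono2) (auto simp: sum_nonneg)
  also have "\<dots> = 2 * 2 powr (1 / p) * B"
    using p B by (simp add: powr_mult powr_powr)
  finally show ?thesis .
qed

lemma tendsto_mean:
  assumes p: "0 < p" and "\<And>v. v \<in> level T r n \<Longrightarrow> (\<lambda>k. F k v) \<longlonglongrightarrow> f v"
  shows "(\<lambda>k. mean T r p n (F k)) \<longlonglongrightarrow> mean T r p n f"
  unfolding mean_def using assms
  by (intro tendsto_powr' tendsto_mult tendsto_sum tendsto_const tendsto_norm)
     (auto intro!: always_eventually divide_nonneg_nonneg sum_nonneg)

lemma tnorm_le_iff:
  "0 \<le> B \<Longrightarrow> tnorm T r p f \<le> ennreal B \<longleftrightarrow> (\<forall>n. mean T r p n f \<le> B)"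
  by (simp add: tnorm_def SUP_le_iff)

lemma mean_le_tnorm: "ennreal (mean T r p n f) \<le> tnorm T r p f"
  unfolding tnorm_def by (rule SUP_upper) simp

lemma tspace_intro:
  assumes "\<And>v. v \<notin> pverts T \<Longrightarrow> f v = 0" and "\<And>n. mean T r p n f \<le> B"
  shows "f \<in> tspace T r p"
proof -
  have "0 \<le> B"
    by (rule order_trans[OF mean_nonneg assms(2)])
  then have "tnorm T r p f \<le> ennreal B"
    using assms by (simp add: tnorm_le_iff)
  then show ?thesis
    using assms(1) by (auto simp: tspace_def intro: le_less_trans)
qed

lemma SUP_tnorm_finiteE:
  assumes "(SUP k. tnorm T r p (F k)) < \<infinity>"
  obtains B where "0 \<le> B" and "\<And>k n. mean T r p n (F k) \<le> B"
proof -
  obtain B where B: "0 \<le> B" "(SUP k. tnorm T r p (F k)) = ennreal B"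
    using assms by (cases "SUP k. tnorm T r p (F k)") auto
  have "tnorm T r p (F k) \<le> ennreal B" for k
    unfolding B(2)[symmetric] by (rule SUP_upper) simp
  with B(1) show thesis
    by (intro that[of B]) (auto simp: tnorm_le_iff)
qed

lemma mean_single_vertex:
  assumes fin: "finite (level T r n)" and v: "v \<in> level T r n" and q: "0 < q"
  shows "mean T r q m (\<lambda>u. if u = v then z else 0) =
    (if m = n then real (card (level T r n)) powr (- (1 / q)) * norm z else 0)"
proof (cases "m = n")
  case True
  have "(\<Sum>u\<in>level T r n. norm (if u = v then z else 0) powr q) =
      (\<Sum>u\<in>level T r n. if u = v then norm z powr q else 0)"
    by (intro sum.cong) auto
  also have "\<dots> = norm z powr q"
    using fin v by simp
  finally show ?thesis
    using True q by (simp add: mean_eq_mult powr_powr)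
next
  case False
  then have "v \<notin> level T r m"
    using v by (simp add: level_def)
  then have "mean T r q m (\<lambda>u. if u = v then z else 0) = mean T r q m (\<lambda>_. 0)"
    by (intro mean_cong) auto
  then show ?thesis
    using False by (simp add: mean_def)
qed

lemma compact_op_imp_tendsto_0:
  assumes fin: "\<And>n. finite (level T r n)" and ne: "\<And>n. level T r n \<noteq> {}"
    and p: "0 < p" "p < q"
    and compact: "compact_op (tspace T r p) (tnorm T r p) (tspace T r q) (tnorm T r q) (mult_op \<psi>)"
  shows "(\<lambda>n. real (card (level T r n)) powr (1 / p - 1 / q) * mean_infty T r n \<psi>) \<longlonglongrightarrow> 0"
    (is "?A \<longlonglongrightarrow> 0")
proof (rule ccontr)
  assume "\<not> ?A \<longlonglongrightarrow> 0"
  have A_nonneg: "0 \<le> ?A n" for n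
    using mean_infty_nonneg[OF fin ne] by simp
  from \<open>\<not> ?A \<longlonglongrightarrow> 0\<close> obtain e where e: "0 < e" "\<not> (\<forall>\<^sub>F n in sequentially. dist (?A n) 0 < e)"
    by (auto simp: tendsto_iff)
  then have "infinite {n. e \<le> ?A n}"
    using A_nonneg by (auto simp: not_eventually frequently_cofinite not_less simp flip: cofinite_eq_sequentially)
  then obtain N :: "nat \<Rightarrow> nat" where N: "strict_mono N" "\<And>k. e \<le> ?A (N k)"
    using infinite_enumerate by blast
  have "\<exists>v. v \<in> level T r n \<and> mean_infty T r n \<psi> = norm (\<psi> v)" for n
    using mean_infty_attained[OF fin ne] by blast
  then obtain v where v: "v n \<in> level T r n" "mean_infty T r n \<psi> = norm (\<psi> (v n))" for n
    by metis
  define c where "c n = real (card (level T r n))" for n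
  have c: "0 < c n" for n
    using fin ne by (auto simp: c_def card_gt_0_iff)
  define F where "F k = (\<lambda>u. if u = v (N k) then complex_of_real (c (N k) powr (1 / p)) else 0)" for k
  have F_le: "mean T r p m (F k) \<le> 1" for k m
    using c[of "N k"] p mean_single_vertex[OF fin v(1), of p] by (simp add: F_def c_def flip: powr_add)
  moreover have "v n \<in> pverts T" for n
    using v(1)[of n] by (simp add: level_def)
  ultimately have F: "F k \<in> tspace T r p" for k
    by (intro tspace_intro[of _ _ _ _ 1]) (auto simp: F_def)
  have "tnorm T r p (F k) \<le> ennreal 1" for k
    by (subst tnorm_le_iff) (use F_le in auto)
  then have "(SUP k. tnorm T r p (F k)) \<le> ennreal 1"
    by (intro SUP_least) auto
  then have "(SUP k. tnorm T r p (F k)) < \<infinity>"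
    by (rule le_less_trans) simp
  then obtain s :: "nat \<Rightarrow> nat" and g where s: "strict_mono s"
    and lim: "(\<lambda>k. tnorm T r q (\<lambda>u. mult_op \<psi> (F (s k)) u - g u)) \<longlonglongrightarrow> 0"
    using compact F unfolding compact_op_def by blast
  have strict: "strict_mono (\<lambda>k. N (s k))"
    using N(1) s by (simp add: strict_mono_def)
  have mean_lim: "(\<lambda>k. mean T r q (n k) (\<lambda>u. mult_op \<psi> (F (s k)) u - g u)) \<longlonglongrightarrow> 0" for n :: "nat \<Rightarrow> nat"
  proof -
    have "(\<lambda>k. ennreal (mean T r q (n k) (\<lambda>u. mult_op \<psi> (F (s k)) u - g u))) \<longlonglongrightarrow> 0"
      by (rule tendsto_sandwich[OF _ _ tendsto_const lim]) (simp_all add: mean_le_tnorm)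
    then show ?thesis
      by (simp add: ennreal_tendsto_0_iff mean_nonneg)
  qed
  have off: "mult_op \<psi> (F k) u = 0" if "u \<in> level T r n" "N k \<noteq> n" for k u n
    using that v(1)[of "N k"] level_disjoint[of u T r] by (auto simp: mult_op_def F_def)
  have "mean T r q n g = 0" for n
  proof -
    have "\<forall>\<^sub>F k in sequentially. n < N (s k)"
      by (rule eventually_compose_filterlim[OF eventually_gt_at_top filterlim_subseq[OF strict]])
    then have "\<forall>\<^sub>F k in sequentially. mean T r q n (\<lambda>u. mult_op \<psi> (F (s k)) u - g u) = mean T r q n g"
      by eventually_elim (auto intro!: mean_cong simp: off)
    then have "(\<lambda>k. mean T r q n g) \<longlonglongrightarrow> 0"
      using mean_lim[of "\<lambda>_. n"] by (rule Lim_transform_eventually[rotated])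
    then show ?thesis
      by (simp add: tendsto_const_iff)
  qed
  then have g: "g u = 0" if "u \<in> level T r n" for u n
    using mean_eq_0_level[OF fin, of q n g u] that p by simp
  have "mean T r q (N (s k)) (\<lambda>u. mult_op \<psi> (F (s k)) u - g u) = ?A (N (s k))" for k
  proof -
    let ?n = "N (s k)"
    have "mean T r q ?n (\<lambda>u. mult_op \<psi> (F (s k)) u - g u) =
        mean T r q ?n (\<lambda>u. if u = v ?n then \<psi> (v ?n) * complex_of_real (c ?n powr (1 / p)) else 0)"
      by (intro mean_cong) (simp add: g mult_op_def F_def)
    also have "\<dots> = c ?n powr (- (1 / q)) * (norm (\<psi> (v ?n)) * c ?n powr (1 / p))"
      using p by (simp add: mean_single_vertex[OF fin v(1)] c_def norm_mult)
    also have "\<dots> = ?A ?n"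
      using c[of ?n] by (simp add: v(2) powr_diff powr_minus field_simps flip: c_def)
    finally show ?thesis .
  qed
  then have "(\<lambda>k. ?A (N (s k))) \<longlonglongrightarrow> 0"
    using mean_lim[of "\<lambda>k. N (s k)"] by simp
  then have "e \<le> 0"
    by (rule LIMSEQ_le_const) (use N(2) in blast)
  with e show False by simp
qed

lemma bounded_means_pointwise_convergent_subsequence:
  assumes fin: "\<And>n. finite (level T r n)" and p: "0 < p"
    and B: "\<And>k n. mean T r p n (F k) \<le> B"
  obtains s :: "nat \<Rightarrow> nat" and f where "strict_mono s"
    and "\<And>v. v \<in> pverts T \<Longrightarrow> (\<lambda>k. F (s k) v) \<longlonglongrightarrow> f v"
    and "\<And>v. v \<notin> pverts T \<Longrightarrow> f v = 0"
proof -
  define b where "b v = 1 + real (card (level T r (depth T r v))) powr (1 / p) * B" for v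
  have "0 \<le> B"
    by (rule order_trans[OF mean_nonneg B])
  then have b: "0 < b v" for v
    by (simp add: b_def add_pos_nonneg)
  have bound: "norm (F k v / of_real (b v)) \<le> 1" if v: "v \<in> pverts T" for k v
  proof -
    have "norm (F k v) \<le> real (card (level T r (depth T r v))) powr (1 / p) * mean T r p (depth T r v) (F k)"
      using fin mem_level_depth[OF v] p by (rule norm_le_mean)
    also have "\<dots> \<le> real (card (level T r (depth T r v))) powr (1 / p) * B"
      using B by (intro mult_left_mono) auto
    finally show ?thesis
      using b[of v] by (simp add: norm_divide) (simp add: b_def)
  qed
  obtain s :: "nat \<Rightarrow> nat" where s: "strict_mono s"
    "\<And>v. v \<in> pverts T \<Longrightarrow> \<exists>l. (\<lambda>k. F (s k) v / of_real (b v)) \<longlonglongrightarrow> l"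
    using function_convergent_subsequence[OF countable_pverts[OF fin],
        of "\<lambda>k v. F k v / of_real (b v)" 1] bound by metis
  have "\<exists>l. (\<lambda>k. F (s k) v) \<longlonglongrightarrow> l" if v: "v \<in> pverts T" for v
  proof -
    obtain l where "(\<lambda>k. F (s k) v / of_real (b v)) \<longlonglongrightarrow> l"
      using s(2)[OF v] by blast
    then have "(\<lambda>k. of_real (b v) * (F (s k) v / of_real (b v))) \<longlonglongrightarrow> of_real (b v) * l"
      by (rule tendsto_mult_left)
    then show ?thesis
      using b[of v] by auto
  qed
  then have "(\<lambda>k. F (s k) v) \<longlonglongrightarrow> lim (\<lambda>k. F (s k) v)" if "v \<in> pverts T" for v
    using that by (simp add: convergent_def flip: convergent_LIMSEQ_iff)
  with s(1) show thesis
    by (intro that[of s "\<lambda>v. if v \<in> pverts T then lim (\<lambda>k. F (s k) v) else 0"]) auto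
qed

lemma tendsto_0_imp_compact_op:
  assumes fin: "\<And>n. finite (level T r n)" and ne: "\<And>n. level T r n \<noteq> {}"
    and p: "0 < p" "p < q"
    and maps: "\<And>f. f \<in> tspace T r p \<Longrightarrow> mult_op \<psi> f \<in> tspace T r q"
    and lim: "(\<lambda>n. real (card (level T r n)) powr (1 / p - 1 / q) * mean_infty T r n \<psi>) \<longlonglongrightarrow> 0"
    (is "?A \<longlonglongrightarrow> 0")
  shows "compact_op (tspace T r p) (tnorm T r p) (tspace T r q) (tnorm T r q) (mult_op \<psi>)"
  unfolding compact_op_def
proof (intro allI impI)
  fix F :: "nat \<Rightarrow> 'a \<Rightarrow> complex"
  assume "(\<forall>k. F k \<in> tspace T r p) \<and> (SUP k. tnorm T r p (F k)) < \<infinity>"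
  then have "(SUP k. tnorm T r p (F k)) < \<infinity>"
    by simp
  then obtain B where B: "0 \<le> B" "\<And>k n. mean T r p n (F k) \<le> B"
    by (rule SUP_tnorm_finiteE) (rule that)
  obtain s :: "nat \<Rightarrow> nat" and f where s: "strict_mono s"
    and f: "\<And>v. v \<in> pverts T \<Longrightarrow> (\<lambda>k. F (s k) v) \<longlonglongrightarrow> f v"
    and f0: "\<And>v. v \<notin> pverts T \<Longrightarrow> f v = 0"
    by (rule bounded_means_pointwise_convergent_subsequence[OF fin p(1) B(2)]) (rule that)
  have f_level: "(\<lambda>k. F (s k) v) \<longlonglongrightarrow> f v" if "v \<in> level T r n" for v n
    using that f by (simp add: level_def)
  have f_le: "mean T r p n f \<le> B" for n
    by (rule LIMSEQ_le_const2[OF tendsto_mean[OF p(1) f_level]]) (use B(2) in auto)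
  define h where "h k = (\<lambda>v. F (s k) v - f v)" for k
  have h: "mult_op \<psi> (h k) = (\<lambda>v. mult_op \<psi> (F (s k)) v - mult_op \<psi> f v)" for k
    by (simp add: mult_op_def h_def algebra_simps fun_eq_iff)
  define K where "K = 1 + 2 * 2 powr (1 / p) * B"
  have K: "0 < K"
    using B(1) by (simp add: K_def add_pos_nonneg)
  have h_le: "mean T r p n (h k) \<le> K" for n k
    using mean_diff_le[OF p(1) B(2)[of n "s k"] f_le] by (simp add: K_def h_def)
  have "(\<lambda>k. tnorm T r q (mult_op \<psi> (h k))) \<longlonglongrightarrow> 0"
  proof (rule tendsto_zero_ennreal)
    fix e :: real
    assume e: "0 < e"
    have "\<forall>\<^sub>F n in sequentially. ?A n < e / 2 / K"
      using order_tendstoD(2)[OF lim, of "e / 2 / K"] e K by simp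
    then obtain N where N: "\<And>n. N \<le> n \<Longrightarrow> ?A n \<le> e / 2 / K"
      unfolding eventually_sequentially by (meson less_imp_le)
    have high: "mean T r q n (mult_op \<psi> (h k)) \<le> e / 2" if "N \<le> n" for n k
    proof -
      have "mean T r q n (mult_op \<psi> (h k)) \<le> ?A n * mean T r p n (h k)"
        by (rule mean_mult_op_le[OF fin ne p])
      also have "\<dots> \<le> e / 2 / K * K"
        using N[OF that] h_le e K by (intro mult_mono) (auto simp: mean_nonneg)
      finally show ?thesis
        using K by simp
    qed
    have "(\<lambda>k. mean T r q n (mult_op \<psi> (h k))) \<longlonglongrightarrow> mean T r q n (\<lambda>_. 0)" for n
    proof (rule tendsto_mean)
      fix v assume "v \<in> level T r n"
      then have "(\<lambda>k. \<psi> v * (F (s k) v - f v)) \<longlonglongrightarrow> \<psi> v * (f v - f v)"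
        by (intro tendsto_intros f_level)
      then show "(\<lambda>k. mult_op \<psi> (h k) v) \<longlonglongrightarrow> 0"
        by (simp add: mult_op_def h_def)
    qed (use p in simp)
    then have "\<forall>\<^sub>F k in sequentially. mean T r q n (mult_op \<psi> (h k)) < e / 2" for n
      using e by (intro order_tendstoD(2)) (auto simp: mean_def)
    then have "\<forall>\<^sub>F k in sequentially. \<forall>n\<in>{..<N}. mean T r q n (mult_op \<psi> (h k)) < e / 2"
      by (intro eventually_ball_finite) auto
    then show "\<forall>\<^sub>F k in sequentially. tnorm T r q (mult_op \<psi> (h k)) < ennreal e"
    proof eventually_elim
      case (elim k)
      have "mean T r q n (mult_op \<psi> (h k)) \<le> e / 2" for n
        using elim high[of n k] by (cases "n < N") (auto simp: less_imp_le)
      then have "tnorm T r q (mult_op \<psi> (h k)) \<le> ennreal (e / 2)"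
        using e by (simp add: tnorm_le_iff)
      also have "\<dots> < ennreal e"
        using e by (simp add: ennreal_less_iff)
      finally show ?case .
    qed
  qed
  moreover have "mult_op \<psi> f \<in> tspace T r q"
    using maps tspace_intro[OF f0 f_le] by blast
  ultimately show "\<exists>(s :: nat \<Rightarrow> nat) g. strict_mono s \<and> g \<in> tspace T r q \<and>
      (\<lambda>k. tnorm T r q (\<lambda>v. mult_op \<psi> (F (s k)) v - g v)) \<longlonglongrightarrow> 0"
    using s unfolding h by blast
qed

theorem theorem10:
  fixes T :: "'v pair_pre_digraph" and r :: 'v and p q :: real and \<psi> :: "'v \<Rightarrow> complex"
  assumes "infinite_rooted_tree T r"
    and "\<And>n. finite (level T r n)"
    and "0 < p" and "p < q"
    and "bounded_op (tspace T r p) (tnorm T r p) (tspace T r q) (tnorm T r q) (mult_op \<psi>)"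
  shows "(compact_op (tspace T r p) (tnorm T r p) (tspace T r q) (tnorm T r q) (mult_op \<psi>) \<longleftrightarrow>
            (\<lambda>n. real (card (level T r n)) powr (1 / p - 1 / q) * mean_infty T r n \<psi>) \<longlonglongrightarrow> 0) \<and>
         ((\<lambda>n. real (card (level T r n)) powr (1 / p - 1 / q) * mean_infty T r n \<psi>) \<longlonglongrightarrow> 0 \<longleftrightarrow>
            (\<lambda>n. mean_infty T r n \<psi>) \<in> o(\<lambda>n. real (card (level T r n)) powr (1 / q - 1 / p)))"
proof
  note fin = assms(2) and ne = level_nonempty[OF assms(1,2)]
  have "mult_op \<psi> f \<in> tspace T r q" if "f \<in> tspace T r p" for f
    using assms(5) that by (simp add: bounded_op_def)
  then show "compact_op (tspace T r p) (tnorm T r p) (tspace T r q) (tnorm T r q) (mult_op \<psi>) \<longleftrightarrow>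
      (\<lambda>n. real (card (level T r n)) powr (1 / p - 1 / q) * mean_infty T r n \<psi>) \<longlonglongrightarrow> 0"
    using compact_op_imp_tendsto_0[OF fin ne assms(3,4)]
      tendsto_0_imp_compact_op[OF fin ne assms(3,4)] by blast
  have card: "card (level T r n) \<noteq> 0" for n
    using fin ne by simp
  have quotient: "real (card (level T r n)) powr (1 / p - 1 / q) * mean_infty T r n \<psi> =
      mean_infty T r n \<psi> / real (card (level T r n)) powr (1 / q - 1 / p)" for n
    using powr_minus_divide[of "real (card (level T r n))" "1 / q - 1 / p"] by simp
  show "(\<lambda>n. real (card (level T r n)) powr (1 / p - 1 / q) * mean_infty T r n \<psi>) \<longlonglongrightarrow> 0 \<longleftrightarrow>
      (\<lambda>n. mean_infty T r n \<psi>) \<in> o(\<lambda>n. real (card (level T r n)) powr (1 / q - 1 / p))"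
    unfolding quotient using card by (auto intro: smalloI_tendsto smalloD_tendsto)
qed

end
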